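(* Let $x^\ast$ be a local minimum of the MPVC. Then there exist multipliers $\alpha\in\mathbb{R}$, $\lambda\in\mathbb{R}^m$, $\mu\in\mathbb{R}^p$, $\eta^H,\eta^G\in\mathbb{R}^q$ such that: (i) $\alpha\nabla f(x^\ast)+\sum_{i=1}^m\lambda_i\nabla g_i(x^\ast)+\sum_{i=1}^p\mu_i\nabla h_i(x^\ast)+\sum_{i=1}^q\eta_i^G\nabla G_i(x^\ast)-\sum_{i=1}^q\eta_i^H\nabla H_i(x^\ast)=0$; (ii) $\alpha\ge0$; $\lambda_i\ge0$ for $i\in I_g$, $\lambda_i=0$ for $i\notin I_g$; $\eta_i^G=0$ for $i\in I_{+-}\cup I_{0-}\cup I_{0+}$, $\eta_i^G\ge0$ for $i\in I_{+0}\cup I_{00}$; $\eta_i^H=0$ for $i\in I_+$, $\eta_i^H\ge0$ for $i\in I_{0-}$, $\eta_i^H$ free for $i\in I_{0+}$; $\eta_i^G\eta_i^H=0$ for $i\in I_{00}$; (iii) $\alpha,\lambda,\mu,\eta^G,\eta^H$ are not all equal to zero; (iv) if $\lambda,\mu,\eta^G,\eta^H$ are not all equal to zero, then there is a sequence $x^k\to x^\ast$ such that for all $k\in\mathbb{N}$: $f(x^k)<f(x^\ast)$; $\lambda_i>0\Rightarrow\lambda_ig_i(x^k)>0$ ($i=1,\dots,m$); $\mu_i\ne0\Rightarrow\mu_ih_i(x^k)>0$ ($i=1,\dots,p$); $\eta_i^H\ne0\Rightarrow\eta_i^HH_i(x^k)<0$ ($i=1,\dots,q$); $\eta_i^G>0\Rightarrow\eta_i^GG_i(x^k)>0$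 ($i=1,\dots,q$).
   Context: The mathematical program with vanishing constraints (MPVC) is: minimize $f(x)$ over $x\in\mathbb{R}^n$ subject to $g_i(x)\le 0$ ($i=1,\dots,m$), $h_i(x)=0$ ($i=1,\dots,p$), $H_i(x)\ge 0$ and $G_i(x)H_i(x)\le 0$ ($i=1,\dots,q$), where all functions $f,g_i,h_i,G_i,H_i:\mathbb{R}^n\to\mathbb{R}$ are continuously differentiable. For a feasible point $x^\ast$ put $I_g=\{i: g_i(x^\ast)=0\}$, $I_+=\{i:H_i(x^\ast)>0\}$, $I_{+0}=\{i:H_i(x^\ast)>0,G_i(x^\ast)=0\}$, $I_{+-}=\{i:H_i(x^\ast)>0,G_i(x^\ast)<0\}$, $I_{00}=\{i:H_i(x^\ast)=0,G_i(x^\ast)=0\}$, $I_{0+}=\{i:H_i(x^\ast)=0,G_i(x^\ast)>0\}$, $I_{0-}=\{i:H_i(x^\ast)=0,G_i(x^\ast)<0\}$. *)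

theory Defs
  imports "HOL-Analysis.Analysis"
begin

definition gradient :: "('a::real_inner \<Rightarrow> real) \<Rightarrow> 'a \<Rightarrow> 'a" where
  "gradient f x = (THE D. GDERIV f x :> D)"

definition cont_differentiable :: "('a::real_inner \<Rightarrow> real) \<Rightarrow> bool" where
  "cont_differentiable f \<longleftrightarrow>
     (\<exists>f'. (\<forall>x. GDERIV f x :> f' x) \<and> continuous_on UNIV f')"

lemma GDERIV_unique:
  assumes "GDERIV f x :> D" "GDERIV f x :> E"
  shows "D = E"
proof -
  have "(\<lambda>v. inner v D) = (\<lambda>v. inner v E)"
    using assms unfolding gderiv_def by (rule has_derivative_unique)
  hence "inner (D - E) D = inner (D - E) E" by meson
  hence "inner (D - E) (D - E) = 0" by (simp add: inner_diff_right)
  thus ?thesis by simp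
qed

lemma gradient_eqI: "GDERIV f x :> D \<Longrightarrow> gradient f x = D"
  unfolding gradient_def using GDERIV_unique by blast

lemma cont_differentiable_iff_gradient:
  "cont_differentiable f \<longleftrightarrow>
     (\<forall>x. GDERIV f x :> gradient f x) \<and> continuous_on UNIV (gradient f)"
proof
  assume "cont_differentiable f"
  then obtain f' where f': "\<forall>x. GDERIV f x :> f' x" "continuous_on UNIV f'"
    unfolding cont_differentiable_def by blast
  have "gradient f = f'" using f'(1) gradient_eqI by blast
  thus "(\<forall>x. GDERIV f x :> gradient f x) \<and> continuous_on UNIV (gradient f)"
    using f' by simp
qed (auto simp: cont_differentiable_def)

text \<open>
  The numbers \<open>m\<close>, \<open>p\<close>, \<open>q\<close> of constraints may be zero, so constraint families are indexed by
  \<open>nat\<close> and only their members with index in \<open>{1..m}\<close>, \<open>{1..p}\<close>, \<open>{1..q}\<close> are relevant.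
\<close>

definition mpvc_feasible ::
  "nat \<Rightarrow> nat \<Rightarrow> nat \<Rightarrow> (nat \<Rightarrow> 'a \<Rightarrow> real) \<Rightarrow> (nat \<Rightarrow> 'a \<Rightarrow> real) \<Rightarrow>
   (nat \<Rightarrow> 'a \<Rightarrow> real) \<Rightarrow> (nat \<Rightarrow> 'a \<Rightarrow> real) \<Rightarrow> 'a set" where
  "mpvc_feasible m p q g h G H =
     {x. (\<forall>i\<in>{1..m}. g i x \<le> 0) \<and> (\<forall>i\<in>{1..p}. h i x = 0) \<and>
         (\<forall>i\<in>{1..q}. H i x \<ge> 0 \<and> G i x * H i x \<le> 0)}"

definition local_minimum_on :: "('a::metric_space \<Rightarrow> real) \<Rightarrow> 'a set \<Rightarrow> 'a \<Rightarrow> bool" where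
  "local_minimum_on f S x \<longleftrightarrow> x \<in> S \<and> (\<exists>e>0. \<forall>y\<in>S \<inter> ball x e. f x \<le> f y)"

text \<open>
  In the index sets below, the first sign in the name refers to \<open>H\<close> and the second to \<open>G\<close>.
\<close>

definition I_g :: "nat \<Rightarrow> (nat \<Rightarrow> 'a \<Rightarrow> real) \<Rightarrow> 'a \<Rightarrow> nat set" where
  "I_g m g x = {i\<in>{1..m}. g i x = 0}"

definition I_pos :: "nat \<Rightarrow> (nat \<Rightarrow> 'a \<Rightarrow> real) \<Rightarrow> 'a \<Rightarrow> nat set" where
  "I_pos q H x = {i\<in>{1..q}. H i x > 0}"

definition I_pos_zero ::
  "nat \<Rightarrow> (nat \<Rightarrow> 'a \<Rightarrow> real) \<Rightarrow> (nat \<Rightarrow> 'a \<Rightarrow> real) \<Rightarrow> 'a \<Rightarrow> nat set" where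
  "I_pos_zero q H G x = {i\<in>{1..q}. H i x > 0 \<and> G i x = 0}"

definition I_pos_neg ::
  "nat \<Rightarrow> (nat \<Rightarrow> 'a \<Rightarrow> real) \<Rightarrow> (nat \<Rightarrow> 'a \<Rightarrow> real) \<Rightarrow> 'a \<Rightarrow> nat set" where
  "I_pos_neg q H G x = {i\<in>{1..q}. H i x > 0 \<and> G i x < 0}"

definition I_zero_zero ::
  "nat \<Rightarrow> (nat \<Rightarrow> 'a \<Rightarrow> real) \<Rightarrow> (nat \<Rightarrow> 'a \<Rightarrow> real) \<Rightarrow> 'a \<Rightarrow> nat set" where
  "I_zero_zero q H G x = {i\<in>{1..q}. H i x = 0 \<and> G i x = 0}"

definition I_zero_pos ::
  "nat \<Rightarrow> (nat \<Rightarrow> 'a \<Rightarrow> real) \<Rightarrow> (nat \<Rightarrow> 'a \<Rightarrow> real) \<Rightarrow> 'a \<Rightarrow> nat set" where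
  "I_zero_pos q H G x = {i\<in>{1..q}. H i x = 0 \<and> G i x > 0}"

definition I_zero_neg ::
  "nat \<Rightarrow> (nat \<Rightarrow> 'a \<Rightarrow> real) \<Rightarrow> (nat \<Rightarrow> 'a \<Rightarrow> real) \<Rightarrow> 'a \<Rightarrow> nat set" where
  "I_zero_neg q H G x = {i\<in>{1..q}. H i x = 0 \<and> G i x < 0}"

end

theory Submission
  imports Defs
begin

text \<open>
  Fix the complementarity pattern at \<open>xs\<close>: demand \<open>H i = 0\<close> for every \<open>i\<close> with \<open>H i xs = 0 \<le> G i xs\<close>,
  and \<open>H i \<ge> 0\<close>, \<open>G i \<le> 0\<close> for the others. Near \<open>xs\<close> this describes a subset of the feasible set that
  contains \<open>xs\<close>, so \<open>xs\<close> is a local minimum of an ordinary nonlinear program, in which moreover no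
  constraint on \<open>G i\<close> is imposed for the biactive indices; hence \<open>\<eta>G i = 0\<close> there. The claim is
  then the enhanced Fritz John theorem for that program, which is proved with minimizers of
  the quadratic penalty functions \<open>f + k/2 * \<Sum>(violation)\<^sup>2 + 1/2 * \<parallel>x - xs\<parallel>\<^sup>2\<close>: their
  normalized stationarity conditions converge along a subsequence.
\<close>

text \<open>Bolzano-Weierstrass applied one index at a time: each new index refines the subsequence
  already chosen, and passing to a further subsequence keeps the limits found so far.\<close>

lemma finite_family_bounded_convergent_subseq:
  fixes u :: "'k \<Rightarrow> nat \<Rightarrow> real"
  assumes "finite K" "\<And>i n. i \<in> K \<Longrightarrow> \<bar>u i n\<bar> \<le> B"
  obtains s l where "strict_mono (s :: nat \<Rightarrow> nat)" "\<And>i. i \<in> K \<Longrightarrow> (u i \<circ> s) \<longlonglongrightarrow> l i"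
proof -
  have "\<exists>s l. strict_mono (s :: nat \<Rightarrow> nat) \<and> (\<forall>i\<in>K. (u i \<circ> s) \<longlonglongrightarrow> l i)"
    using assms
  proof (induction K rule: finite_induct)
    case empty
    have "strict_mono (id :: nat \<Rightarrow> nat)" by (simp add: strict_mono_id)
    then show ?case by auto
  next
    case (insert j K)
    then obtain s l where s: "strict_mono (s :: nat \<Rightarrow> nat)" "\<forall>i\<in>K. (u i \<circ> s) \<longlonglongrightarrow> l i"
      by (metis insertI2)
    have "bounded (range (u j \<circ> s))"
      using insert.prems[of j] by (auto simp: bounded_iff)
    then obtain a r where r: "strict_mono (r :: nat \<Rightarrow> nat)" "((u j \<circ> s) \<circ> r) \<longlonglongrightarrow> a"
      using bounded_imp_convergent_subsequence by blast
    have "(u i \<circ> (s \<circ> r)) \<longlonglongrightarrow> (l(j := a)) i" if "i \<in> insert j K" for i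
      using that s(2) r LIMSEQ_subseq_LIMSEQ[of "u i \<circ> s" "l i" r]
      by (cases "i = j") (auto simp: o_assoc)
    then show ?case
      using strict_mono_o[OF s(1) r(1)] by blast
  qed
  then show ?thesis using that by blast
qed

text \<open>For equalities the signed value is kept rather than its absolute value: the square is
  the same, and the sign later becomes that of the multiplier.\<close>

definition violation :: "bool \<Rightarrow> real \<Rightarrow> real" where
  "violation eq t = (if eq then t else max 0 t)"

lemma violation_zero_iff: "violation eq t = 0 \<longleftrightarrow> (if eq then t = 0 else t \<le> 0)"
  by (auto simp: violation_def)

lemma violation_nonneg: "0 \<le> violation False t"
  by (simp add: violation_def)

text \<open>Lets the sign of a nonzero penalty coefficient be read as the sign of the constraint
  value itself.\<close>

lemma violation_nonzero_eq: "violation eq t \<noteq> 0 \<Longrightarrow> violation eq t = t"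
  by (auto simp: violation_def max_def split: if_splits)

lemma continuous_on_violation [continuous_intros]:
  "continuous_on S c \<Longrightarrow> continuous_on S (\<lambda>x. violation eq (c x))"
  unfolding violation_def by (cases eq) (auto intro!: continuous_intros)

text \<open>Squaring smooths the kink of the positive part at 0, so the penalty stays differentiable
  everywhere.\<close>

lemma DERIV_violation_squared:
  "((\<lambda>t. (violation eq t)\<^sup>2) has_field_derivative 2 * violation eq t) (at t)"
proof (cases eq)
  case True
  then show ?thesis
    by (auto simp: violation_def intro!: derivative_eq_intros)
next
  case False
  consider "t > 0" | "t < 0" | "t = 0" by linarith
  then show ?thesis
  proof cases
    case 1
    have "((\<lambda>t::real. t\<^sup>2) has_field_derivative 2 * t) (at t)"
      by (auto intro!: derivative_eq_intros)
    moreover have "\<forall>\<^sub>F y in nhds t. (violation eq y)\<^sup>2 = y\<^sup>2"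
      using 1 False eventually_nhds_in_open[of "{0<..}" t]
      by (auto simp: violation_def elim!: eventually_mono)
    ultimately show ?thesis
      using 1 False by (simp add: DERIV_cong_ev violation_def)
  next
    case 2
    have "\<forall>\<^sub>F y in nhds t. (violation eq y)\<^sup>2 = 0"
      using 2 False eventually_nhds_in_open[of "{..<0}" t]
      by (auto simp: violation_def elim!: eventually_mono)
    from DERIV_cong_ev[OF refl this refl] show ?thesis
      using 2 False by (simp add: violation_def)
  next
    \<comment> \<open>At the kink the increment factors with the continuous slope
      \<open>max 0 z\<close>, so Caratheodory's criterion gives derivative 0.\<close>
    case 3
    have "(violation eq z)\<^sup>2 - (violation eq t)\<^sup>2 = max 0 z * (z - t)" for z
      using 3 False by (auto simp: violation_def max_def power2_eq_square)
    moreover have "isCont (\<lambda>z::real. max 0 z) t"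
      by (intro continuous_intros)
    ultimately show ?thesis
      using 3 False unfolding CARAT_DERIV by (intro exI[of _ "max 0"]) (auto simp: violation_def)
  qed
qed

section \<open>Gradients and stationarity of the penalized objective\<close>

lemma GDERIV_imp_continuous_on:
  assumes "\<And>x. GDERIV c x :> D x"
  shows "continuous_on S c"
  using assms unfolding gderiv_def
  by (meson continuous_at_imp_continuous_on has_derivative_continuous)

lemma GDERIV_local_min_zero:
  assumes "GDERIV F x :> D" "open U" "x \<in> U" "\<And>y. y \<in> U \<Longrightarrow> F x \<le> F y"
  shows "D = 0"
proof -
  have "(\<lambda>h. inner h D) = (\<lambda>h. 0)"
    using assms unfolding gderiv_def by (intro differential_zero_maxmin[of x U F]) auto
  then have "inner D D = 0" by meson
  then show ?thesis by simp
qed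

text \<open>The factors \<open>r / 2\<close> and \<open>1 / 2\<close> cancel the 2 produced by
  squaring, so each constraint gradient carries the coefficient \<open>r\<close> times the
  violation: the multiplier before normalization.\<close>

lemma GDERIV_penalty:
  assumes f: "GDERIV f x :> Df" and c: "\<And>i. i \<in> K \<Longrightarrow> GDERIV (c i) x :> Dc i"
  shows "GDERIV (\<lambda>x. f x + r / 2 * (\<Sum>i\<in>K. (violation (eq i) (c i x))\<^sup>2) + 1 / 2 * (norm (x - a))\<^sup>2) x
           :> Df + r *\<^sub>R (\<Sum>i\<in>K. violation (eq i) (c i x) *\<^sub>R Dc i) + (x - a)"
proof -
  have v: "((\<lambda>x. (violation (eq i) (c i x))\<^sup>2) has_derivative
           (\<lambda>h. 2 * violation (eq i) (c i x) * inner h (Dc i))) (at x)" if "i \<in> K" for i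
    using has_derivative_compose[OF c[OF that, unfolded gderiv_def]
        DERIV_violation_squared[unfolded has_field_derivative_def]] .
  have n: "((\<lambda>x. (norm (x - a))\<^sup>2) has_derivative (\<lambda>h. 2 * inner h (x - a))) (at x)"
    unfolding power2_norm_eq_inner
    by (auto intro!: derivative_eq_intros simp: inner_commute)
  show ?thesis
    unfolding gderiv_def
    by (rule has_derivative_eq_rhs,
        rule has_derivative_add[OF has_derivative_add[OF f[unfolded gderiv_def]
            has_derivative_mult_right[OF has_derivative_sum[OF v]]] has_derivative_mult_right[OF n]])
      (auto simp: inner_add_right inner_sum_right sum_distrib_left inner_commute algebra_simps)
qed

text \<open>Only active constraints are listed; inactive ones hold near \<open>a\<close> by
  continuity and can be absorbed in the choice of \<open>e\<close>. A multiplier is a limit of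
  normalized penalty coefficients, so a nonzero one fixes the sign of its constraint along the
  minimizers, and a positive penalty there must be paid for by a decrease of
  \<open>f\<close>.\<close>

theorem enhanced_fritz_john:
  fixes f :: "'a::euclidean_space \<Rightarrow> real" and c :: "'k \<Rightarrow> 'a \<Rightarrow> real"
  assumes K: "finite K"
    and Df: "\<And>x. GDERIV f x :> Df x" "continuous_on UNIV Df"
    and Dc: "\<And>i x. i \<in> K \<Longrightarrow> GDERIV (c i) x :> Dc i x" "\<And>i. i \<in> K \<Longrightarrow> continuous_on UNIV (Dc i)"
    and active: "\<And>i. i \<in> K \<Longrightarrow> c i a = 0"
    and e: "e > 0"
    and local_min: "\<And>y. y \<in> ball a e \<Longrightarrow> (\<And>i. i \<in> K \<Longrightarrow> if eq i then c i y = 0 else c i y \<le> 0) \<Longrightarrow> f a \<le> f y"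
  obtains \<alpha> \<nu> where
    "\<alpha> \<ge> 0" "\<alpha> *\<^sub>R Df a + (\<Sum>i\<in>K. \<nu> i *\<^sub>R Dc i a) = 0"
    "\<And>i. i \<in> K \<Longrightarrow> \<not> eq i \<Longrightarrow> \<nu> i \<ge> 0"
    "\<not> (\<alpha> = 0 \<and> (\<forall>i\<in>K. \<nu> i = 0))"
    "\<exists>i\<in>K. \<nu> i \<noteq> 0 \<Longrightarrow>
      \<exists>x. x \<longlonglongrightarrow> a \<and> (\<forall>n::nat. f (x n) < f a \<and> (\<forall>i\<in>K. \<nu> i \<noteq> 0 \<longrightarrow> \<nu> i * c i (x n) > 0))"
proof -

  \<comment> \<open>Minimizers of the penalized problems and their limit\<close>
  define v where "v i x = violation (eq i) (c i x)" for i x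
  define P where "P x = (\<Sum>i\<in>K. (v i x)\<^sup>2)" for x
  define F where "F k x = f x + real k / 2 * P x + 1 / 2 * (norm (x - a))\<^sup>2" for k x
  \<comment> \<open>Half the radius gives a compact set, on which minimizers exist, inside the open
    ball where \<open>local_min\<close> applies.\<close>
  define C where "C = cball a (e / 2)"
  have contf: "continuous_on S f" for S by (rule GDERIV_imp_continuous_on[OF Df(1)])
  have contv: "continuous_on S (v i)" if "i \<in> K" for S i
    unfolding v_def using GDERIV_imp_continuous_on[OF Dc(1)[OF that]] by (intro continuous_intros)
  have contP: "continuous_on S P" for S
    unfolding P_def using contv by (auto intro!: continuous_intros)
  have contF: "continuous_on S (F k)" for S k
    unfolding F_def by (intro continuous_intros contf contP)
  have P_nonneg: "P x \<ge> 0" for x by (simp add: P_def sum_nonneg)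
  have "P a = 0" using active by (auto simp: P_def v_def violation_zero_iff intro!: sum.neutral)
  then have Fa: "F k a = f a" for k by (simp add: F_def)
  have aC: "a \<in> C" using e by (simp add: C_def)
  have "\<exists>x\<in>C. \<forall>y\<in>C. F k x \<le> F k y" for k
    using aC by (intro continuous_attains_inf contF) (auto simp: C_def)
  then obtain X where X: "\<And>k. X k \<in> C" "\<And>k y. y \<in> C \<Longrightarrow> F k (X k) \<le> F k y"
    by metis
  \<comment> \<open>Comparison with the value at \<open>a\<close>, where penalty and proximal term
    vanish. This inequality yields feasibility of the limit, its coincidence with \<open>a\<close>,
    and the decrease of \<open>f\<close>.\<close>
  have FX: "f (X k) + real k / 2 * P (X k) + 1 / 2 * (norm (X k - a))\<^sup>2 \<le> f a" for k
    using X(2)[OF aC, of k] unfolding Fa by (simp add: F_def)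
  obtain b s where s: "b \<in> C" "strict_mono (s :: nat \<Rightarrow> nat)" "(X \<circ> s) \<longlonglongrightarrow> b"
    using X(1) compact_imp_seq_compact[of C] unfolding seq_compact_def C_def
    by (metis compact_cball)
  have limf: "(\<lambda>n. f (X (s n))) \<longlonglongrightarrow> f b"
    using continuous_on_tendsto_compose[OF contf[of UNIV] s(3)] by (simp add: o_def)
  have limP: "(\<lambda>n. P (X (s n))) \<longlonglongrightarrow> P b"
    using continuous_on_tendsto_compose[OF contP[of UNIV] s(3)] by (simp add: o_def)
  have limn: "(\<lambda>n. 1 / 2 * (norm (X (s n) - a))\<^sup>2) \<longlonglongrightarrow> 1 / 2 * (norm (b - a))\<^sup>2"
    using s(3) by (auto simp: o_def intro!: tendsto_intros)
  have s_inf: "filterlim (\<lambda>n. real (s n)) at_top sequentially"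
    using filterlim_compose[OF filterlim_real_sequentially filterlim_subseq[OF s(2)]] .
  \<comment> \<open>The comparison bounds \<open>k * P (X k)\<close> by twice the gap in
    \<open>f\<close>, which converges along the subsequence; dividing by \<open>k\<close> sends the
    penalty to 0.\<close>
  have Pb: "P b = 0"
  proof -
    have "real (s n) * P (X (s n)) \<le> 2 * (f a - f (X (s n)))" for n
      using FX[of "s n"] zero_le_power2[of "norm (X (s n) - a)"]
      unfolding times_divide_eq_left by argo
    then have "P (X (s n)) \<le> 2 * (f a - f (X (s n))) * inverse (real (s n))" if "real (s n) > 0" for n
      using that by (simp add: field_simps)
    moreover have "\<forall>\<^sub>F n in sequentially. real (s n) > 0"
      using s_inf unfolding filterlim_at_top_dense by (rule spec)
    ultimately have "\<forall>\<^sub>F n in sequentially. P (X (s n)) \<le> 2 * (f a - f (X (s n))) * inverse (real (s n))"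
      by (auto elim: eventually_mono)
    moreover have "(\<lambda>n. 2 * (f a - f (X (s n))) * inverse (real (s n))) \<longlonglongrightarrow> 2 * (f a - f b) * 0"
      by (intro tendsto_intros limf tendsto_inverse_0_at_top s_inf)
    ultimately have "P b \<le> 0"
      using tendsto_le[OF _ _ limP] by fastforce
    then show ?thesis using P_nonneg[of b] by simp
  qed
  \<comment> \<open>Feasibility of \<open>b\<close> gives one bound; the opposite one below retains
    the proximal term, which therefore must vanish, so \<open>b = a\<close>.\<close>
  have "f a \<le> f b"
  proof (rule local_min)
    show "b \<in> ball a e" using s(1) e by (simp add: C_def)
    fix i assume "i \<in> K"
    then have "v i b = 0"
      using Pb K by (simp add: P_def sum_nonneg_eq_0_iff)
    then show "if eq i then c i b = 0 else c i b \<le> 0"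
      by (simp add: v_def violation_zero_iff)
  qed
  moreover have "f b + 1 / 2 * (norm (b - a))\<^sup>2 \<le> f a"
  proof (rule LIMSEQ_le_const2[OF tendsto_add[OF limf limn]])
    have "f (X (s n)) + 1 / 2 * (norm (X (s n) - a))\<^sup>2 \<le> f a" for n
      using FX[of "s n"] P_nonneg[of "X (s n)"]
      by (smt (verit) divide_nonneg_pos mult_nonneg_nonneg of_nat_0_le_iff)
    then show "\<exists>N. \<forall>n\<ge>N. f (X (s n)) + 1 / 2 * (norm (X (s n) - a))\<^sup>2 \<le> f a" by blast
  qed
  ultimately have "(norm (b - a))\<^sup>2 \<le> 0" by linarith
  then have ba: "b = a" by simp

  \<comment> \<open>Normalized multipliers and their limits\<close>
  define \<delta> where "\<delta> k = sqrt (1 + (real k)\<^sup>2 * P (X k))" for k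
  have \<delta>1: "\<delta> k \<ge> 1" for k
    using P_nonneg[of "X k"] by (simp add: \<delta>_def)
  \<comment> \<open>\<open>\<delta> k\<close> is the Euclidean norm of the vector with entries 1 and
    \<open>k * v i (X k)\<close>, which may be unbounded in \<open>k\<close>; dividing by it gives
    unit vectors. The index \<open>None\<close> holds the entry of the objective.\<close>
  define u where "u j k = (case j of None \<Rightarrow> 1 / \<delta> k | Some i \<Rightarrow> real k * v i (X k) / \<delta> k)" for j k
  define K' where "K' = insert None (Some ` K)"
  have sum_u: "(\<Sum>j\<in>K'. (u j k)\<^sup>2) = 1" for k
  proof -
    have "(\<Sum>j\<in>K'. (u j k)\<^sup>2) = (1 + (\<Sum>i\<in>K. (real k * v i (X k))\<^sup>2)) / (\<delta> k)\<^sup>2"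
      using K by (simp add: K'_def u_def sum.reindex power_divide sum_divide_distrib add_divide_distrib)
    also have "\<dots> = (1 + (real k)\<^sup>2 * P (X k)) / (\<delta> k)\<^sup>2"
      by (simp add: P_def power_mult_distrib sum_distrib_left)
    also have "(\<delta> k)\<^sup>2 = 1 + (real k)\<^sup>2 * P (X k)"
      using P_nonneg[of "X k"] by (simp add: \<delta>_def)
    also have "(1 + (real k)\<^sup>2 * P (X k)) / \<dots> = 1"
      using P_nonneg[of "X k"] by (simp add: add_nonneg_eq_0_iff)
    finally show ?thesis .
  qed
  have K': "finite K'" using K by (simp add: K'_def)
  have u_le: "\<bar>(u j \<circ> s) n\<bar> \<le> 1" if "j \<in> K'" for j n
  proof -
    have "(u j (s n))\<^sup>2 \<le> 1"
      using member_le_sum[of j K' "\<lambda>j. (u j (s n))\<^sup>2"] that K' sum_u[of "s n"] by simp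
    then show ?thesis by (simp add: abs_square_le_1)
  qed
  obtain r l where r: "strict_mono (r :: nat \<Rightarrow> nat)"
    and "\<And>j. j \<in> K' \<Longrightarrow> ((u j \<circ> s) \<circ> r) \<longlonglongrightarrow> l j"
    using finite_family_bounded_convergent_subseq[of K' "\<lambda>j. u j \<circ> s", OF K' u_le] by blast
  then have l: "\<And>j. j \<in> K' \<Longrightarrow> (\<lambda>n. u j (s (r n))) \<longlonglongrightarrow> l j" by (simp add: o_def)
  define Y where "Y n = X (s (r n))" for n
  have Y: "Y \<longlonglongrightarrow> a"
    using LIMSEQ_subseq_LIMSEQ[OF s(3) r] by (simp add: o_def Y_def[abs_def] ba)
  define \<alpha> where "\<alpha> = l None"
  define \<nu> where "\<nu> i = l (Some i)" for i
  have lim\<alpha>: "(\<lambda>n. u None (s (r n))) \<longlonglongrightarrow> \<alpha>" using l by (simp add: \<alpha>_def K'_def)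
  have lim\<nu>: "(\<lambda>n. u (Some i) (s (r n))) \<longlonglongrightarrow> \<nu> i" if "i \<in> K" for i
    using l that by (simp add: \<nu>_def K'_def)
  show ?thesis
  proof (rule that)
    show "\<alpha> \<ge> 0"
      by (rule LIMSEQ_le_const[OF lim\<alpha>]) (use \<delta>1 in \<open>auto simp: u_def intro: order_trans[OF zero_le_one]\<close>)
    show "\<nu> i \<ge> 0" if "i \<in> K" "\<not> eq i" for i
    proof (rule LIMSEQ_le_const[OF lim\<nu>[OF that(1)]], intro exI allI impI)
      fix n
      have "v i (X (s (r n))) \<ge> 0"
        using that by (simp add: v_def violation_nonneg)
      then show "0 \<le> u (Some i) (s (r n))"
        using \<delta>1[of "s (r n)"] by (simp add: u_def)
    qed
    \<comment> \<open>The unit norm survives the limit since \<open>K'\<close> is finite, so the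
      limit multipliers cannot all vanish.\<close>
    have "(\<lambda>n. \<Sum>j\<in>K'. (u j (s (r n)))\<^sup>2) \<longlonglongrightarrow> (\<Sum>j\<in>K'. (l j)\<^sup>2)"
      by (intro tendsto_intros l)
    then have "(\<Sum>j\<in>K'. (l j)\<^sup>2) = 1"
      by (simp add: sum_u LIMSEQ_const_iff)
    then have "\<alpha>\<^sup>2 + (\<Sum>i\<in>K. (\<nu> i)\<^sup>2) = 1"
      using K by (simp add: K'_def \<alpha>_def \<nu>_def sum.reindex)
    then show "\<not> (\<alpha> = 0 \<and> (\<forall>i\<in>K. \<nu> i = 0))"
      by (intro notI) (simp add: sum.neutral)
    show "\<alpha> *\<^sub>R Df a + (\<Sum>i\<in>K. \<nu> i *\<^sub>R Dc i a) = 0"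
    proof -
      \<comment> \<open>The stationarity condition divided by \<open>\<delta>\<close>; its last
        summand, from the proximal term, tends to 0.\<close>
      define L where "L n = u None (s (r n)) *\<^sub>R Df (Y n) + (\<Sum>i\<in>K. u (Some i) (s (r n)) *\<^sub>R Dc i (Y n))
          + u None (s (r n)) *\<^sub>R (Y n - a)" for n
      \<comment> \<open>The minimizers eventually lie in the interior of \<open>C\<close>, where the
        full gradient of \<open>F k\<close> vanishes.\<close>
      have "\<forall>\<^sub>F n in sequentially. Y n \<in> ball a (e / 2)"
        using Y e by (intro topological_tendstoD) auto
      moreover have "L n = 0" if Yn: "Y n \<in> ball a (e / 2)" for n
      proof -
        define k where "k = s (r n)"
        have Yk: "Y n = X k" by (simp add: Y_def k_def)
        have "Df (X k) + real k *\<^sub>R (\<Sum>i\<in>K. v i (X k) *\<^sub>R Dc i (X k)) + (X k - a) = 0"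
        proof (rule GDERIV_local_min_zero)
          show "GDERIV (F k) (X k) :> Df (X k) + real k *\<^sub>R (\<Sum>i\<in>K. v i (X k) *\<^sub>R Dc i (X k)) + (X k - a)"
            unfolding F_def P_def v_def by (intro GDERIV_penalty Df Dc)
          show "X k \<in> ball a (e / 2)" using Yn Yk by simp
          show "F k (X k) \<le> F k y" if "y \<in> ball a (e / 2)" for y
            using X(2) that by (simp add: C_def)
        qed simp
        then have "(1 / \<delta> k) *\<^sub>R (Df (X k) + real k *\<^sub>R (\<Sum>i\<in>K. v i (X k) *\<^sub>R Dc i (X k)) + (X k - a)) = 0"
          by simp
        moreover have "(1 / \<delta> k) *\<^sub>R real k *\<^sub>R (\<Sum>i\<in>K. v i (X k) *\<^sub>R Dc i (X k))
            = (\<Sum>i\<in>K. u (Some i) k *\<^sub>R Dc i (X k))"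
          by (simp add: u_def scaleR_sum_right)
        ultimately show ?thesis
          by (simp add: L_def Yk k_def[symmetric] scaleR_add_right) (simp add: u_def)
      qed
      ultimately have "\<forall>\<^sub>F n in sequentially. L n = 0" by (rule eventually_mono)
      then have "L \<longlonglongrightarrow> 0" by (rule tendsto_eventually)
      moreover have "L \<longlonglongrightarrow> \<alpha> *\<^sub>R Df a + (\<Sum>i\<in>K. \<nu> i *\<^sub>R Dc i a) + \<alpha> *\<^sub>R (a - a)"
        unfolding L_def
        by (intro tendsto_intros lim\<alpha> lim\<nu> Y continuous_on_tendsto_compose[OF Df(2) Y]
            continuous_on_tendsto_compose[OF Dc(2) Y]) auto
      ultimately have "0 = \<alpha> *\<^sub>R Df a + (\<Sum>i\<in>K. \<nu> i *\<^sub>R Dc i a) + \<alpha> *\<^sub>R (a - a)"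
        by (rule LIMSEQ_unique)
      then show ?thesis by simp
    qed

    \<comment> \<open>Constraint signs and decrease of the objective along the sequence\<close>
    assume "\<exists>i\<in>K. \<nu> i \<noteq> 0"
    then obtain j where j: "j \<in> K" "\<nu> j \<noteq> 0" by blast
    \<comment> \<open>The product tends to a positive square, so the normalized coefficient
      eventually has the sign of its limit.\<close>
    have "\<forall>\<^sub>F n in sequentially. \<nu> i * u (Some i) (s (r n)) > 0" if "i \<in> K" "\<nu> i \<noteq> 0" for i
    proof (rule order_tendstoD)
      show "(\<lambda>n. \<nu> i * u (Some i) (s (r n))) \<longlonglongrightarrow> \<nu> i * \<nu> i"
        by (intro tendsto_intros lim\<nu> that)
      show "0 < \<nu> i * \<nu> i" using that(2) not_real_square_gt_zero by blast
    qed
    then have "\<forall>\<^sub>F n in sequentially. \<forall>i\<in>K. \<nu> i \<noteq> 0 \<longrightarrow> \<nu> i * u (Some i) (s (r n)) > 0"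
      using K by (intro eventually_ball_finite) auto
    then obtain N where N: "\<And>n i. n \<ge> N \<Longrightarrow> i \<in> K \<Longrightarrow> \<nu> i \<noteq> 0 \<Longrightarrow> \<nu> i * u (Some i) (s (r n)) > 0"
      unfolding eventually_sequentially by blast
    \<comment> \<open>\<open>u (Some i) k\<close> is the violation times
      \<open>k / \<delta> k\<close>. Here \<open>k = 0\<close> would make the product vanish, so
      this factor is positive and the sign passes to the violation, which is nonzero and hence
      equals \<open>c i\<close>.\<close>
    have sgn: "s (r n) > 0 \<and> v i (Y n) \<noteq> 0 \<and> \<nu> i * c i (Y n) > 0"
      if "n \<ge> N" "i \<in> K" "\<nu> i \<noteq> 0" for n i
    proof -
      define k where "k = s (r n)"
      have "\<nu> i * (real k * v i (X k) / \<delta> k) > 0"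
        using N[OF that] by (simp add: u_def k_def)
      then have prod: "0 < (\<nu> i * v i (X k)) * (real k / \<delta> k)" by (simp add: mult_ac)
      then have "k > 0" by (intro Nat.gr0I) auto
      moreover from this have "0 < real k / \<delta> k" using \<delta>1[of k] by simp
      with prod have pos: "\<nu> i * v i (X k) > 0" by (rule zero_less_mult_pos2)
      moreover from this have "v i (X k) \<noteq> 0" by auto
      moreover from this have "v i (X k) = c i (X k)"
        unfolding v_def by (intro violation_nonzero_eq)
      ultimately show ?thesis by (simp add: Y_def k_def)
    qed
    \<comment> \<open>The nonzero multiplier of \<open>j\<close> makes the penalty positive, so the
      comparison with \<open>a\<close> becomes strict.\<close>
    have "f (Y n) < f a" if "n \<ge> N" for n
    proof -
      have *: "s (r n) > 0" "v j (Y n) \<noteq> 0" using sgn[OF that j] by auto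
      have "0 < (v j (Y n))\<^sup>2" using * by simp
      also have "\<dots> \<le> P (Y n)"
        unfolding P_def by (rule member_le_sum[of j K "\<lambda>i. (v i (Y n))\<^sup>2"]) (use j K in auto)
      finally have "real (s (r n)) / 2 * P (Y n) > 0" using * by simp
      then show ?thesis
        using FX[of "s (r n)"] zero_le_power2[of "norm (Y n - a)"]
        unfolding Y_def times_divide_eq_left by linarith
    qed
    moreover have "(\<lambda>n. Y (n + N)) \<longlonglongrightarrow> a" using Y by (rule LIMSEQ_ignore_initial_segment)
    ultimately show "\<exists>x. x \<longlonglongrightarrow> a \<and>
        (\<forall>n::nat. f (x n) < f a \<and> (\<forall>i\<in>K. \<nu> i \<noteq> 0 \<longrightarrow> \<nu> i * c i (x n) > 0))"
      using sgn by (intro exI[of _ "\<lambda>n. Y (n + N)"]) auto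
  qed
qed

theorem theorem4p1:
  fixes f :: "real ^ 'n \<Rightarrow> real"
    and m p q :: nat
    and g h G H :: "nat \<Rightarrow> real ^ 'n \<Rightarrow> real"
    and xs :: "real ^ 'n"
  assumes "cont_differentiable f"
    and "\<forall>i\<in>{1..m}. cont_differentiable (g i)"
    and "\<forall>i\<in>{1..p}. cont_differentiable (h i)"
    and "\<forall>i\<in>{1..q}. cont_differentiable (G i)"
    and "\<forall>i\<in>{1..q}. cont_differentiable (H i)"
    and "local_minimum_on f (mpvc_feasible m p q g h G H) xs"
  shows "\<exists>(\<alpha>::real) (lam :: nat \<Rightarrow> real) (\<mu> :: nat \<Rightarrow> real) (\<eta>H :: nat \<Rightarrow> real) (\<eta>G :: nat \<Rightarrow> real).
    \<alpha> *\<^sub>R gradient f xs + (\<Sum>i=1..m. lam i *\<^sub>R gradient (g i) xs)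
      + (\<Sum>i=1..p. \<mu> i *\<^sub>R gradient (h i) xs)
      + (\<Sum>i=1..q. \<eta>G i *\<^sub>R gradient (G i) xs)
      - (\<Sum>i=1..q. \<eta>H i *\<^sub>R gradient (H i) xs) = 0
    \<and>
    (\<alpha> \<ge> 0 \<and>
     (\<forall>i\<in>I_g m g xs. lam i \<ge> 0) \<and>
     (\<forall>i\<in>{1..m} - I_g m g xs. lam i = 0) \<and>
     (\<forall>i\<in>I_pos_neg q H G xs \<union> I_zero_neg q H G xs \<union> I_zero_pos q H G xs. \<eta>G i = 0) \<and>
     (\<forall>i\<in>I_pos_zero q H G xs \<union> I_zero_zero q H G xs. \<eta>G i \<ge> 0) \<and>
     (\<forall>i\<in>I_pos q H xs. \<eta>H i = 0) \<and>
     (\<forall>i\<in>I_zero_neg q H G xs. \<eta>H i \<ge> 0) \<and>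
     (\<forall>i\<in>I_zero_zero q H G xs. \<eta>G i * \<eta>H i = 0))
    \<and>
    \<not> (\<alpha> = 0 \<and> (\<forall>i\<in>{1..m}. lam i = 0) \<and> (\<forall>i\<in>{1..p}. \<mu> i = 0) \<and>
       (\<forall>i\<in>{1..q}. \<eta>G i = 0) \<and> (\<forall>i\<in>{1..q}. \<eta>H i = 0))
    \<and>
    (\<not> ((\<forall>i\<in>{1..m}. lam i = 0) \<and> (\<forall>i\<in>{1..p}. \<mu> i = 0) \<and>
        (\<forall>i\<in>{1..q}. \<eta>G i = 0) \<and> (\<forall>i\<in>{1..q}. \<eta>H i = 0)) \<longrightarrow>
     (\<exists>x :: nat \<Rightarrow> real ^ 'n. x \<longlonglongrightarrow> xs \<and>
        (\<forall>k. f (x k) < f xs \<and>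
           (\<forall>i\<in>{1..m}. lam i > 0 \<longrightarrow> lam i * g i (x k) > 0) \<and>
           (\<forall>i\<in>{1..p}. \<mu> i \<noteq> 0 \<longrightarrow> \<mu> i * h i (x k) > 0) \<and>
           (\<forall>i\<in>{1..q}. \<eta>H i \<noteq> 0 \<longrightarrow> \<eta>H i * H i (x k) < 0) \<and>
           (\<forall>i\<in>{1..q}. \<eta>G i > 0 \<longrightarrow> \<eta>G i * G i (x k) > 0))))"
proof -

  \<comment> \<open>The nonlinear program attached to the MPVC\<close>
  note GD = cont_differentiable_iff_gradient
  define A where "A = I_g m g xs"
  \<comment> \<open>Of the constraints \<open>G i \<le> 0\<close> only those active with
    \<open>H i xs > 0\<close> enter: biactive indices are covered by \<open>H i = 0\<close>, and
    strict negativity persists near \<open>xs\<close>.\<close>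
  define B where "B = I_pos_zero q H G xs"
  define D where "D = {i\<in>{1..q}. H i xs = 0}"
  define K where "K = A <+> {1..p} <+> B <+> D"
  \<comment> \<open>Entering \<open>H i \<ge> 0\<close> as \<open>- H i \<le> 0\<close> produces the
    minus sign before the \<open>H\<close> sum and the reversed inequality for \<open>H\<close>
    along the sequence.\<close>
  define c where "c = case_sum g (case_sum h (case_sum G (\<lambda>i x. - H i x)))"
  define Dc where "Dc = case_sum (\<lambda>i. gradient (g i)) (case_sum (\<lambda>i. gradient (h i))
      (case_sum (\<lambda>i. gradient (G i)) (\<lambda>i x. - gradient (H i) x)))"
  \<comment> \<open>\<open>H i\<close> is an equality constraint when \<open>G i xs \<ge> 0\<close>,
    so among the indices of \<open>D\<close> only those with \<open>G i xs < 0\<close> force a sign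
    on \<open>\<eta>H\<close>.\<close>
  define eq where "eq = case_sum (\<lambda>i::nat. False) (case_sum (\<lambda>i::nat. True)
      (case_sum (\<lambda>i::nat. False) (\<lambda>i. G i xs \<ge> 0)))"
  have sub: "A \<subseteq> {1..m}" "B \<subseteq> {1..q}" "D \<subseteq> {1..q}"
    by (auto simp: A_def B_def D_def I_g_def I_pos_zero_def)
  then have fin: "finite A" "finite B" "finite D"
    by (auto intro: finite_subset)
  have feas: "\<And>i. i \<in> {1..m} \<Longrightarrow> g i xs \<le> 0" "\<And>i. i \<in> {1..p} \<Longrightarrow> h i xs = 0"
    "\<And>i. i \<in> {1..q} \<Longrightarrow> H i xs \<ge> 0" "\<And>i. i \<in> {1..q} \<Longrightarrow> G i xs * H i xs \<le> 0"
    using assms(6) by (auto simp: local_minimum_on_def mpvc_feasible_def)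
  have cont: "isCont k xs" if "cont_differentiable k" for k :: "real ^ 'n \<Rightarrow> real"
    using that GDERIV_imp_continuous_on[of k "gradient k" UNIV] GD
    by (auto simp: continuous_on_eq_continuous_at)
  have neg: "\<forall>\<^sub>F y in nhds xs. k y < 0" if "cont_differentiable k" "k xs < 0" for k
    using order_tendstoD(2)[OF cont[OF that(1), unfolded continuous_at tendsto_at_iff_tendsto_nhds] that(2)] .
  have pos: "\<forall>\<^sub>F y in nhds xs. k y > 0" if "cont_differentiable k" "k xs > 0" for k
    using order_tendstoD(1)[OF cont[OF that(1), unfolded continuous_at tendsto_at_iff_tendsto_nhds] that(2)] .
  \<comment> \<open>Strict inequalities at \<open>xs\<close> persist nearby, uniformly over the
    finite index sets; this allows the inactive constraints to be dropped.\<close>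
  have "\<forall>\<^sub>F y in nhds xs. (\<forall>i\<in>{1..m}. g i xs < 0 \<longrightarrow> g i y < 0)
      \<and> (\<forall>i\<in>{1..q}. G i xs < 0 \<longrightarrow> G i y < 0) \<and> (\<forall>i\<in>{1..q}. H i xs > 0 \<longrightarrow> H i y > 0)"
    using neg pos assms(2-5)
    by (intro eventually_conj eventually_ball_finite ballI) auto
  then obtain e1 where e1: "e1 > 0"
    "\<forall>y. dist y xs < e1 \<longrightarrow> (\<forall>i\<in>{1..m}. g i xs < 0 \<longrightarrow> g i y < 0)
      \<and> (\<forall>i\<in>{1..q}. G i xs < 0 \<longrightarrow> G i y < 0) \<and> (\<forall>i\<in>{1..q}. H i xs > 0 \<longrightarrow> H i y > 0)"
    unfolding eventually_nhds_metric by blast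
  obtain e2 where e2: "e2 > 0" "\<forall>y \<in> mpvc_feasible m p q g h G H \<inter> ball xs e2. f xs \<le> f y"
    using assms(6) by (auto simp: local_minimum_on_def)
  define e where "e = min e1 e2"
  have e: "e > 0" using e1(1) e2(1) by (simp add: e_def)
  have near: "g i xs < 0 \<Longrightarrow> i \<in> {1..m} \<Longrightarrow> g i y < 0"
      "G j xs < 0 \<Longrightarrow> j \<in> {1..q} \<Longrightarrow> G j y < 0" "H j xs > 0 \<Longrightarrow> j \<in> {1..q} \<Longrightarrow> H j y > 0"
    if "y \<in> ball xs e" for y i j
    using e1(2) that by (auto simp: e_def dist_commute)
  have minimal: "f xs \<le> f y" if "y \<in> ball xs e" "y \<in> mpvc_feasible m p q g h G H" for y
    using e2(2) that by (simp add: e_def)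
  have ball_K: "(\<forall>k\<in>K. Q k) \<longleftrightarrow> (\<forall>i\<in>A. Q (Inl i)) \<and> (\<forall>i\<in>{1..p}. Q (Inr (Inl i)))
      \<and> (\<forall>i\<in>B. Q (Inr (Inr (Inl i)))) \<and> (\<forall>i\<in>D. Q (Inr (Inr (Inr i))))" for Q
    unfolding K_def by auto
  obtain \<alpha> \<nu> where fj: "\<alpha> \<ge> 0" "\<alpha> *\<^sub>R gradient f xs + (\<Sum>k\<in>K. \<nu> k *\<^sub>R Dc k xs) = 0"
    "\<forall>k\<in>K. \<not> eq k \<longrightarrow> \<nu> k \<ge> 0"
    "\<not> (\<alpha> = 0 \<and> (\<forall>k\<in>K. \<nu> k = 0))"
    "\<not> (\<forall>k\<in>K. \<nu> k = 0) \<Longrightarrow>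
      \<exists>x. x \<longlonglongrightarrow> xs \<and> (\<forall>n::nat. f (x n) < f xs \<and> (\<forall>k\<in>K. \<nu> k \<noteq> 0 \<longrightarrow> \<nu> k * c k (x n) > 0))"
  proof (rule enhanced_fritz_john[of K f "gradient f" c Dc xs e eq])
    show "finite K" using fin by (simp add: K_def)
    have "\<forall>k\<in>K. (\<forall>x. GDERIV (c k) x :> Dc k x) \<and> continuous_on UNIV (Dc k)"
      using assms(2-5) sub unfolding ball_K
      by (auto simp: c_def Dc_def GD intro!: GDERIV_minus continuous_intros)
    then show "GDERIV (c k) x :> Dc k x" "continuous_on UNIV (Dc k)" if "k \<in> K" for k x
      using that by auto
    have "\<forall>k\<in>K. c k xs = 0"
      using feas unfolding ball_K
      by (auto simp: c_def A_def B_def D_def I_g_def I_pos_zero_def)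
    then show "c k xs = 0" if "k \<in> K" for k using that by auto
    show "f xs \<le> f y" if y: "y \<in> ball xs e"
      and "\<And>k. k \<in> K \<Longrightarrow> if eq k then c k y = 0 else c k y \<le> 0" for y
    proof (rule minimal[OF y])
      have "\<forall>k\<in>K. if eq k then c k y = 0 else c k y \<le> 0" using that by blast
      then have yc: "\<forall>i\<in>A. g i y \<le> 0" "\<forall>i\<in>{1..p}. h i y = 0" "\<forall>i\<in>B. G i y \<le> 0"
        "\<forall>i\<in>D. if G i xs \<ge> 0 then H i y = 0 else H i y \<ge> 0"
        unfolding ball_K by (auto simp: c_def eq_def)
      have "g i y \<le> 0" if i: "i \<in> {1..m}" for i
        using yc(1) near(1)[OF y _ i] feas(1)[OF i] i by (fastforce simp: A_def I_g_def)
      moreover have "H i y \<ge> 0 \<and> G i y * H i y \<le> 0" if i: "i \<in> {1..q}" for i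
      proof (cases "H i xs = 0")
        \<comment> \<open>Either \<open>H i y = 0\<close> kills the product, or
          \<open>G i xs < 0\<close> persists at \<open>y\<close> and \<open>H i y \<ge> 0\<close> is
          imposed.\<close>
        case True
        then have "i \<in> D" using i by (simp add: D_def)
        then show ?thesis
          using yc(4) near(2)[OF y _ i] by (cases "G i xs \<ge> 0") (auto simp: mult_le_0_iff)
      next
        \<comment> \<open>Feasibility of \<open>xs\<close> leaves \<open>G i xs = 0\<close>, where
          \<open>i\<close> is in \<open>B\<close>, or \<open>G i xs < 0\<close>, which persists at
          \<open>y\<close>.\<close>
        case False
        then have H: "H i xs > 0" using feas(3)[OF i] by simp
        then have "G i xs \<le> 0" using feas(4)[OF i] by (auto simp: mult_le_0_iff)
        then have "G i y \<le> 0"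
          using near(2)[OF y _ i] yc(3) H i by (fastforce simp: B_def I_pos_zero_def)
        then show ?thesis using near(3)[OF y H i] by (simp add: mult_le_0_iff)
      qed
      ultimately show "y \<in> mpvc_feasible m p q g h G H"
        using yc(2) by (simp add: mpvc_feasible_def)
    qed
    show "GDERIV f x :> gradient f x" "continuous_on UNIV (gradient f)" for x
      using assms(1) GD by auto
    show "e > 0" by (rule e)
  next
    fix \<alpha> \<nu>
    assume "\<alpha> \<ge> 0" "\<alpha> *\<^sub>R gradient f xs + (\<Sum>k\<in>K. \<nu> k *\<^sub>R Dc k xs) = 0"
      "\<And>k. k \<in> K \<Longrightarrow> \<not> eq k \<Longrightarrow> \<nu> k \<ge> 0" "\<not> (\<alpha> = 0 \<and> (\<forall>k\<in>K. \<nu> k = 0))"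
      "\<exists>k\<in>K. \<nu> k \<noteq> 0 \<Longrightarrow>
        \<exists>x. x \<longlonglongrightarrow> xs \<and> (\<forall>n::nat. f (x n) < f xs \<and> (\<forall>k\<in>K. \<nu> k \<noteq> 0 \<longrightarrow> \<nu> k * c k (x n) > 0))"
    then show thesis by (intro that[of \<alpha> \<nu>]) auto
  qed

  \<comment> \<open>Multipliers of the MPVC\<close>
  define lam where "lam i = (if i \<in> A then \<nu> (Inl i) else 0)" for i
  define \<mu> where "\<mu> i = \<nu> (Inr (Inl i))" for i
  \<comment> \<open>\<open>B\<close> contains no biactive index, so the zero extension gives
    \<open>\<eta>G i * \<eta>H i = 0\<close> there whatever \<open>\<eta>H i\<close> is.\<close>
  define \<eta>G where "\<eta>G i = (if i \<in> B then \<nu> (Inr (Inr (Inl i))) else 0)" for i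
  define \<eta>H where "\<eta>H i = (if i \<in> D then \<nu> (Inr (Inr (Inr i))) else 0)" for i
  note mult_defs = lam_def \<mu>_def \<eta>G_def \<eta>H_def
  \<comment> \<open>Collapses the sums over full index ranges to \<open>A\<close>, \<open>B\<close>
    and \<open>D\<close>, matching the pieces of the sum over \<open>K\<close>.\<close>
  have sum_if: "(\<Sum>i\<in>S. (if i \<in> T then \<phi> i else 0) *\<^sub>R w i) = (\<Sum>i\<in>T. \<phi> i *\<^sub>R w i)"
    if "T \<subseteq> S" "finite S" for S T :: "nat set" and \<phi> and w :: "nat \<Rightarrow> real ^ 'n"
    using that by (intro sum.mono_neutral_cong_right) auto
  have "\<alpha> *\<^sub>R gradient f xs + (\<Sum>i=1..m. lam i *\<^sub>R gradient (g i) xs)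
      + (\<Sum>i=1..p. \<mu> i *\<^sub>R gradient (h i) xs)
      + (\<Sum>i=1..q. \<eta>G i *\<^sub>R gradient (G i) xs)
      - (\<Sum>i=1..q. \<eta>H i *\<^sub>R gradient (H i) xs) = 0"
    using fj(2) fin unfolding mult_defs sub[THEN sum_if, OF finite_atLeastAtMost]
    by (simp add: K_def sum.Plus Dc_def sum_negf algebra_simps)
  moreover have "\<alpha> \<ge> 0 \<and>
     (\<forall>i\<in>I_g m g xs. lam i \<ge> 0) \<and>
     (\<forall>i\<in>{1..m} - I_g m g xs. lam i = 0) \<and>
     (\<forall>i\<in>I_pos_neg q H G xs \<union> I_zero_neg q H G xs \<union> I_zero_pos q H G xs. \<eta>G i = 0) \<and>
     (\<forall>i\<in>I_pos_zero q H G xs \<union> I_zero_zero q H G xs. \<eta>G i \<ge> 0) \<and>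
     (\<forall>i\<in>I_pos q H xs. \<eta>H i = 0) \<and>
     (\<forall>i\<in>I_zero_neg q H G xs. \<eta>H i \<ge> 0) \<and>
     (\<forall>i\<in>I_zero_zero q H G xs. \<eta>G i * \<eta>H i = 0)"
    using fj(1,3) unfolding ball_K mult_defs
    by (auto simp: eq_def A_def B_def D_def I_pos_zero_def I_pos_neg_def I_zero_neg_def
        I_zero_pos_def I_zero_zero_def I_pos_def)
  \<comment> \<open>The zero extension adds no nonzero entries, so nontriviality and the premise of
    the sequence claim both carry over.\<close>
  moreover have all_zero: "(\<forall>k\<in>K. \<nu> k = 0) \<longleftrightarrow>
      (\<forall>i\<in>{1..m}. lam i = 0) \<and> (\<forall>i\<in>{1..p}. \<mu> i = 0) \<and>
      (\<forall>i\<in>{1..q}. \<eta>G i = 0) \<and> (\<forall>i\<in>{1..q}. \<eta>H i = 0)"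
    using sub unfolding ball_K mult_defs by (auto split: if_splits)
  moreover have "\<exists>x :: nat \<Rightarrow> real ^ 'n. x \<longlonglongrightarrow> xs \<and>
        (\<forall>k. f (x k) < f xs \<and>
           (\<forall>i\<in>{1..m}. lam i > 0 \<longrightarrow> lam i * g i (x k) > 0) \<and>
           (\<forall>i\<in>{1..p}. \<mu> i \<noteq> 0 \<longrightarrow> \<mu> i * h i (x k) > 0) \<and>
           (\<forall>i\<in>{1..q}. \<eta>H i \<noteq> 0 \<longrightarrow> \<eta>H i * H i (x k) < 0) \<and>
           (\<forall>i\<in>{1..q}. \<eta>G i > 0 \<longrightarrow> \<eta>G i * G i (x k) > 0))"
    if nz: "\<not> (\<forall>k\<in>K. \<nu> k = 0)"
  proof -
    obtain x where x: "x \<longlonglongrightarrow> xs" "\<And>n. f (x n) < f xs"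
      "\<And>n. \<forall>k\<in>K. \<nu> k \<noteq> 0 \<longrightarrow> \<nu> k * c k (x n) > 0"
      using fj(5)[OF nz] by blast
    have "(\<forall>i\<in>{1..m}. lam i > 0 \<longrightarrow> lam i * g i (x n) > 0) \<and>
           (\<forall>i\<in>{1..p}. \<mu> i \<noteq> 0 \<longrightarrow> \<mu> i * h i (x n) > 0) \<and>
           (\<forall>i\<in>{1..q}. \<eta>H i \<noteq> 0 \<longrightarrow> \<eta>H i * H i (x n) < 0) \<and>
           (\<forall>i\<in>{1..q}. \<eta>G i > 0 \<longrightarrow> \<eta>G i * G i (x n) > 0)" for n
      using x(3)[of n] unfolding ball_K mult_defs by (auto simp: c_def)
    then show ?thesis using x(1,2) by blast
  qed
  ultimately show ?thesis
    using fj(4) by (intro exI[of _ \<alpha>] exI[of _ lam] exI[of _ \<mu>] exI[of _ \<eta>H] exI[of _ \<eta>G]) blast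
qed

end
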